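(* Let $\mathcal G=(\mathcal V_0,\mathcal E)$ be a finite undirected graph and let $\mathcal V_1,\dots,\mathcal V_m\subseteq\mathcal V_0$ be $m$ connected vertex sets with $\mathcal V_i\cap\mathcal V_{i'}=\emptyset$ for $i\ne i'$. Write $\mathcal V=\cup_{i=1}^m\mathcal V_i$. Then $$\prod_{i=1}^m\mathcal H(\mathcal V_i)\le\mathcal H(\mathcal V)\le\Big\{\prod_{i=1}^m\mathcal H(\mathcal V_i)\Big\}\times\exp\Big[b(\{\mathcal V_i\}_{i=1}^m)\Big\{2\log\Big(\sum_{i=1}^m|\mathcal V_i|\Big)+\log(2)\Big\}\Big].$$
   Context: A (nonempty) vertex set $\mathcal V\subseteq\mathcal V_0$ is connected under $\mathcal G$ if any two of its vertices are joined by a path of $\mathcal G$ all of whose vertices lie in $\mathcal V$. $d_{\mathcal G}(\boldsymbol v_1,\boldsymbol v_2)$ is the length (number of edges) of a shortest path between two vertices, and $d_{\mathcal G}(\mathcal V_1,\mathcal V_2)=\min_{\boldsymbol v_1\in\mathcal V_1,\boldsymbol v_2\in\mathcal V_2}d_{\mathcal G}(\boldsymbol v_1,\boldsymbol v_2)$. For connected $\mathcal V$, $\mathcal H(\mathcal V)$ is the number of spanning trees of $\mathcal V$ under $\mathcal G$ (spanning trees of the subgraph induced on $\mathcal V$). A general vertex set decomposes uniquely as $\mathcal V=\cup_j\mathcal V_j$ with each $\mathcal V_j$ connected and $d_{\mathcal G}(\mathcal V_j,\mathcal V_{j'})>1$ for $j\ne j'$, and then $\mathcal H(\mathcal V)=\prod_j\mathcal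 H(\mathcal V_j)$. For disjoint vertex sets, $b(\{\mathcal V_i\}_{i=1}^m)=\sum_{i<i'}b(\{\mathcal V_i,\mathcal V_{i'}\})$, where $b(\{\mathcal V_i,\mathcal V_{i'}\})$ is the number of edges of $\mathcal G$ connecting $\mathcal V_i$ and $\mathcal V_{i'}$. *)

theory Defs
  imports Complex_Main "HOL-Library.Extended_Nat"
begin

text \<open>Finite simple undirected graphs are pairs of a vertex set and a set of two-element edges.\<close>

type_synonym 'a ugraph = "'a set \<times> 'a set set"

abbreviation vertices :: "'a ugraph \<Rightarrow> 'a set" where
  "vertices G \<equiv> fst G"

abbreviation edges :: "'a ugraph \<Rightarrow> 'a set set" where
  "edges G \<equiv> snd G"

definition finite_ugraph :: "'a ugraph \<Rightarrow> bool" where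
  "finite_ugraph G \<longleftrightarrow> finite (vertices G) \<and> (\<forall>e\<in>edges G. e \<subseteq> vertices G \<and> card e = 2)"

definition path_between :: "'a ugraph \<Rightarrow> 'a \<Rightarrow> 'a \<Rightarrow> 'a list \<Rightarrow> bool" where
  "path_between G u v p \<longleftrightarrow>
     p \<noteq> [] \<and> hd p = u \<and> last p = v \<and> distinct p \<and> set p \<subseteq> vertices G \<and>
     successively (\<lambda>x y. {x, y} \<in> edges G) p"

definition connected_set :: "'a ugraph \<Rightarrow> 'a set \<Rightarrow> bool" where
  "connected_set G W \<longleftrightarrow>
     W \<noteq> {} \<and> W \<subseteq> vertices G \<and>
     (\<forall>u\<in>W. \<forall>v\<in>W. \<exists>p. path_between G u v p \<and> set p \<subseteq> W)"

text \<open>Distances are extended naturals: two vertices not joined by any path have distance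
  \<open>\<infinity>\<close>, the infimum of the empty set.\<close>

definition vertex_dist :: "'a ugraph \<Rightarrow> 'a \<Rightarrow> 'a \<Rightarrow> enat" where
  "vertex_dist G u v = (INF p\<in>{p. path_between G u v p}. enat (length p - 1))"

definition set_dist :: "'a ugraph \<Rightarrow> 'a set \<Rightarrow> 'a set \<Rightarrow> enat" where
  "set_dist G A B = (INF u\<in>A. INF v\<in>B. vertex_dist G u v)"

definition cycle :: "'a ugraph \<Rightarrow> 'a list \<Rightarrow> bool" where
  "cycle G p \<longleftrightarrow>
     3 \<le> length p \<and> distinct p \<and>
     successively (\<lambda>x y. {x, y} \<in> edges G) p \<and> {last p, hd p} \<in> edges G"

definition tree :: "'a ugraph \<Rightarrow> bool" where
  "tree T \<longleftrightarrow> connected_set T (vertices T) \<and> (\<nexists>p. cycle T p)"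

text \<open>A spanning tree of the subgraph induced on \<open>W\<close> is identified with its edge set, as its
  vertex set is \<open>W\<close>.\<close>

definition spanning_trees :: "'a ugraph \<Rightarrow> 'a set \<Rightarrow> 'a set set set" where
  "spanning_trees G W = {F. F \<subseteq> {e \<in> edges G. e \<subseteq> W} \<and> tree (W, F)}"

definition connected_decomposition :: "'a ugraph \<Rightarrow> 'a set \<Rightarrow> 'a set set \<Rightarrow> bool" where
  "connected_decomposition G W P \<longleftrightarrow>
     \<Union>P = W \<and> (\<forall>A\<in>P. connected_set G A) \<and>
     (\<forall>A\<in>P. \<forall>B\<in>P. A \<noteq> B \<longrightarrow> set_dist G A B > 1)"

text \<open>The number \<open>\<H>(W)\<close>. For \<open>W \<subseteq> vertices G\<close> the description is well defined by
  \<open>ex1_connected_decomposition\<close> below, and for connected \<open>W\<close> it gives the number of spanning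
  trees of \<open>W\<close>, see \<open>num_spanning_connected\<close>.\<close>

definition num_spanning :: "'a ugraph \<Rightarrow> 'a set \<Rightarrow> nat" where
  "num_spanning G W =
     (\<Prod>A\<in>(THE P. connected_decomposition G W P). card (spanning_trees G A))"

definition edges_between :: "'a ugraph \<Rightarrow> 'a set \<Rightarrow> 'a set \<Rightarrow> nat" where
  "edges_between G A B = card {e \<in> edges G. \<exists>u\<in>A. \<exists>v\<in>B. e = {u, v}}"

definition total_edges_between :: "'a ugraph \<Rightarrow> nat \<Rightarrow> (nat \<Rightarrow> 'a set) \<Rightarrow> nat" where
  "total_edges_between G m V = (\<Sum>i=1..m. \<Sum>i'=i+1..m. edges_between G (V i) (V i'))"

lemma set_dist_le_1:
  assumes "{u, v} \<in> edges G" "u \<noteq> v" "u \<in> vertices G" "v \<in> vertices G" "u \<in> A" "v \<in> B"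
  shows "set_dist G A B \<le> 1"
proof -
  have "path_between G u v [u, v]"
    using assms by (auto simp: path_between_def)
  then have "vertex_dist G u v \<le> enat (length [u, v] - 1)"
    unfolding vertex_dist_def by (intro INF_lower) auto
  then have "vertex_dist G u v \<le> 1" by (simp add: one_enat_def)
  moreover have "set_dist G A B \<le> vertex_dist G u v"
    unfolding set_dist_def using assms(5,6) by (intro INF_lower2[of u] INF_lower) auto
  ultimately show ?thesis by order
qed

lemma connected_decomposition_absorbs:
  assumes G: "finite_ugraph G" and Q: "connected_decomposition G W Q"
    and A: "connected_set G A" "A \<subseteq> W" and a: "a \<in> A" "a \<in> B" "B \<in> Q"
  shows "A \<subseteq> B"
proof
  fix x assume "x \<in> A"
  with A a obtain p where p: "path_between G a x p" "set p \<subseteq> A"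
    unfolding connected_set_def by blast
  have step: "y \<in> B" if "x \<in> B" "y \<in> W" "{x, y} \<in> edges G" for x y
  proof -
    from Q that obtain B' where B': "B' \<in> Q" "y \<in> B'"
      unfolding connected_decomposition_def by blast
    from G that(3) have "x \<noteq> y" "x \<in> vertices G" "y \<in> vertices G"
      unfolding finite_ugraph_def by (auto dest!: bspec)
    with that B' have "set_dist G B B' \<le> 1" by (intro set_dist_le_1)
    with Q a(3) B' have "B = B'"
      unfolding connected_decomposition_def by (metis leD)
    with B' show ?thesis by simp
  qed
  have "set q \<subseteq> B" if "q \<noteq> []" "hd q \<in> B" "set q \<subseteq> W"
      "successively (\<lambda>x y. {x, y} \<in> edges G) q" for q
    using that
  proof (induction q)
    case (Cons a q)
    show ?case
    proof (cases "q = []")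
      case False
      then have "hd q \<in> W" using Cons.prems(3) hd_in_set[OF False] by (simp add: subset_iff)
      moreover have "a \<in> B" "{a, hd q} \<in> edges G" "successively (\<lambda>x y. {x, y} \<in> edges G) q"
        using Cons.prems False by (simp_all add: successively_Cons)
      ultimately show ?thesis using step[of a "hd q"] Cons.IH False Cons.prems(3) by simp
    qed (use Cons.prems in simp)
  qed simp
  from this[of p] p a A have "set p \<subseteq> B" unfolding path_between_def by auto
  moreover have "x \<in> set p" using p last_in_set[of p] unfolding path_between_def by auto
  ultimately show "x \<in> B" by (rule subsetD)
qed

lemma connected_decomposition_subset:
  assumes G: "finite_ugraph G" and P: "connected_decomposition G W P"
    and Q: "connected_decomposition G W Q"
  shows "P \<subseteq> Q"
proof
  fix A assume A: "A \<in> P"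
  have conn: "connected_set G C \<and> C \<subseteq> W" if "C \<in> R" "connected_decomposition G W R" for C R
    using that by (auto simp: connected_decomposition_def)
  from conn[OF A P] obtain a where a: "a \<in> A" by (auto simp: connected_set_def)
  with conn[OF A P] have "a \<in> W" by auto
  with Q obtain B where B: "B \<in> Q" "a \<in> B" by (auto simp: connected_decomposition_def)
  have "connected_set G A" "A \<subseteq> W" "connected_set G B" "B \<subseteq> W"
    using conn[OF A P] conn[OF B(1) Q] by simp_all
  then have "A = B"
    using connected_decomposition_absorbs[OF G Q _ _ a B(2,1)]
      connected_decomposition_absorbs[OF G P _ _ B(2) a A] by (intro subset_antisym)
  with B show "A \<in> Q" by simp
qed

lemma path_between_of_rtrancl:
  assumes "(u, v) \<in> {(x, y). x \<in> W \<and> y \<in> W \<and> {x, y} \<in> edges G}\<^sup>*" "u \<in> W" "W \<subseteq> vertices G"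
  shows "\<exists>p. path_between G u v p \<and> set p \<subseteq> W"
  using assms(1)
proof (induction rule: rtrancl_induct)
  case base
  have "path_between G u u [u]" using assms by (auto simp: path_between_def)
  with assms show ?case by (intro exI[of _ "[u]"]) auto
next
  case (step y z)
  then obtain p where p: "path_between G u y p" "set p \<subseteq> W" by blast
  show ?case
  proof (cases "z \<in> set p")
    case True
    then obtain xs ys where "p = xs @ z # ys" by (meson split_list)
    with p have "path_between G u z (xs @ [z])" "set (xs @ [z]) \<subseteq> W"
      by (auto simp: path_between_def successively_append_iff hd_append)
    then show ?thesis by blast
  next
    case False
    with p step(2) assms(3) have "path_between G u z (p @ [z])" "set (p @ [z]) \<subseteq> W"
      by (auto simp: path_between_def successively_append_iff)
    then show ?thesis by blast
  qed
qed

lemma ex_connected_decomposition: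
  assumes "W \<subseteq> vertices G"
  shows "\<exists>P. connected_decomposition G W P"
proof -
  define r where "r = {(x, y). x \<in> W \<and> y \<in> W \<and> {x, y} \<in> edges G}"
  define C where "C = (\<lambda>u. {v. (u, v) \<in> r\<^sup>*})"
  have "sym r" unfolding r_def by (auto simp: sym_def insert_commute)
  then have sym: "sym (r\<^sup>*)" by (rule sym_rtrancl)
  have C_eq: "C u = C v" if "(u, v) \<in> r\<^sup>*" for u v
    using rtrancl_trans[OF that] rtrancl_trans[OF symD[OF sym that]] unfolding C_def by blast
  have inW: "v \<in> W" if "(u, v) \<in> r\<^sup>*" "u \<in> W" for u v
    using that by (induction rule: rtrancl_induct) (auto simp: r_def)
  have CW: "C u \<subseteq> W" if "u \<in> W" for u
    using inW that unfolding C_def by blast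
  have "\<Union>(C ` W) = W"
    using CW by (auto simp: C_def)
  moreover have "connected_set G (C u)" if u: "u \<in> W" for u
    unfolding connected_set_def
  proof (intro conjI ballI)
    show "C u \<noteq> {}" by (auto simp: C_def)
    show "C u \<subseteq> vertices G" using CW[OF u] assms by blast
    fix x y assume xy: "x \<in> C u" "y \<in> C u"
    then have "(x, u) \<in> r\<^sup>*" "(u, y) \<in> r\<^sup>*"
      using sym unfolding C_def by (auto dest: symD)
    then have "(x, y) \<in> r\<^sup>*" by (rule rtrancl_trans)
    then have "(x, y) \<in> {(a, b). a \<in> C u \<and> b \<in> C u \<and> {a, b} \<in> edges G}\<^sup>*"
    proof (induction rule: rtrancl_induct)
      case (step y z)
      have "(u, y) \<in> r\<^sup>*"
        using rtrancl_trans[OF _ step(1)] xy(1) unfolding C_def by blast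
      moreover from this have "(u, z) \<in> r\<^sup>*"
        using step(2) by (rule rtrancl_into_rtrancl)
      ultimately show ?case
        using step(2,3) by (intro rtrancl_into_rtrancl[OF step(3)]) (auto simp: C_def r_def)
    qed auto
    then show "\<exists>p. path_between G x y p \<and> set p \<subseteq> C u"
      using xy(1) \<open>C u \<subseteq> vertices G\<close> by (rule path_between_of_rtrancl)
  qed
  moreover have "set_dist G (C u) (C v) > 1" if uv: "u \<in> W" "v \<in> W" "C u \<noteq> C v" for u v
  proof -
    have "2 \<le> enat (length p - 1)" if p: "path_between G x y p" "x \<in> C u" "y \<in> C v" for x y p
    proof (rule ccontr)
      assume "\<not> 2 \<le> enat (length p - 1)"
      then have len: "length p \<le> 2" by (simp add: numeral_eq_enat)
      have xyW: "x \<in> W" "y \<in> W" using p CW[OF uv(1)] CW[OF uv(2)] by (simp_all add: subset_iff)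
      have "(x, y) \<in> r\<^sup>*"
      proof (cases p)
        case Nil
        with p show ?thesis by (simp add: path_between_def)
      next
        case (Cons a q)
        then show ?thesis
        proof (cases q)
          case Nil
          with Cons p show ?thesis by (auto simp: path_between_def)
        next
          case (Cons b q')
          with \<open>p = a # q\<close> len have "p = [a, b]" by simp
          with p xyW have "(x, y) \<in> r" by (auto simp: path_between_def r_def)
          then show ?thesis by blast
        qed
      qed
      then have "C x = C y" by (rule C_eq)
      moreover have "C u = C x" using p(2) by (intro C_eq) (simp add: C_def)
      moreover have "C v = C y" using p(3) by (intro C_eq) (simp add: C_def)
      ultimately show False using uv by simp
    qed
    then have "2 \<le> set_dist G (C u) (C v)"
      unfolding set_dist_def vertex_dist_def by (intro INF_greatest) auto
    moreover have "(1::enat) < 2" by (simp add: one_enat_def numeral_eq_enat)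
    ultimately show ?thesis by order
  qed
  ultimately have "connected_decomposition G W (C ` W)"
    unfolding connected_decomposition_def by blast
  then show ?thesis by blast
qed

lemma ex1_connected_decomposition:
  assumes "finite_ugraph G" "W \<subseteq> vertices G"
  shows "\<exists>!P. connected_decomposition G W P"
  using ex_connected_decomposition[OF assms(2)]
    subset_antisym[OF connected_decomposition_subset connected_decomposition_subset, OF assms(1) _ _ assms(1)]
  by (auto intro: ex_ex1I)

lemma num_spanning_connected:
  assumes "finite_ugraph G" "connected_set G W"
  shows "num_spanning G W = card (spanning_trees G W)"
proof -
  have "connected_decomposition G W {W}"
    using assms(2) by (simp add: connected_decomposition_def)
  moreover have "W \<subseteq> vertices G" using assms(2) by (simp add: connected_set_def)
  ultimately have "(THE P. connected_decomposition G W P) = {W}"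
    using ex1_connected_decomposition[OF assms(1)] by (intro the1_equality) auto
  then show ?thesis by (simp add: num_spanning_def)
qed

end

theory Submission
  imports Defs "HOL-Library.Disjoint_Sets"
begin

text \<open>The number \<open>\<H>(W)\<close> counts the bases of the graphic matroid of the edges inside \<open>W\<close>, and
  \<open>\<Prod>i. \<H>(V\<^sub>i)\<close> counts the bases that remain once the edges joining different \<open>V\<^sub>i\<close> are deleted.
  Restoring an edge \<open>e\<close> never decreases the number of bases. A basis containing \<open>e\<close> is turned
  into a basis of the smaller matroid by exchanging \<open>e\<close> for some edge \<open>f\<close> (with \<open>f = e\<close> standing
  for mere deletion), and each basis of the smaller matroid is hit at most once per choice of
  \<open>f\<close>. Hence every restored edge multiplies the number of bases by at most \<open>1 + |E| \<le> 2n\<^sup>2\<close>, where \<open>n = |V|\<close>.\<close>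

section \<open>Edge connectivity and the closure operator of the graphic matroid\<close>

definition conn :: "'a set set \<Rightarrow> ('a \<times> 'a) set" where
  "conn F = {(x, y). {x, y} \<in> F}\<^sup>*"

text \<open>Sets that are not of the form \<open>{x, y}\<close> belong to every span, so that spans are extensive
  without any assumption on \<open>F\<close>.\<close>

definition edge_span :: "'a set set \<Rightarrow> 'a set set" where
  "edge_span F = {e. \<forall>x y. e = {x, y} \<longrightarrow> (x, y) \<in> conn F}"

text \<open>These are the maximal forests inside \<open>E\<close>. No vertex set enters, so
  \<open>E\<close> may be changed edge by edge and connected and disconnected graphs are treated
  alike.\<close>

definition bases :: "'a set set \<Rightarrow> 'a set set set" where
  "bases E = {F. F \<subseteq> E \<and> E \<subseteq> edge_span F \<and> (\<forall>e\<in>F. e \<notin> edge_span (F - {e}))}"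

lemma conn_sym: "(x, y) \<in> conn F \<Longrightarrow> (y, x) \<in> conn F"
proof -
  have "sym {(x, y). {x, y} \<in> F}" by (auto simp: sym_def insert_commute)
  then show "(x, y) \<in> conn F \<Longrightarrow> (y, x) \<in> conn F"
    unfolding conn_def by (meson sym_rtrancl symD)
qed

lemma conn_trans: "(x, y) \<in> conn F \<Longrightarrow> (y, z) \<in> conn F \<Longrightarrow> (x, z) \<in> conn F"
  unfolding conn_def by (rule rtrancl_trans)

lemma conn_mono: "F \<subseteq> F' \<Longrightarrow> conn F \<subseteq> conn F'"
  unfolding conn_def by (intro rtrancl_mono) auto

lemma doubleton_in_edge_span: "{x, y} \<in> edge_span F \<longleftrightarrow> (x, y) \<in> conn F"
  unfolding edge_span_def by (auto simp: doubleton_eq_iff intro: conn_sym)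

lemma edge_span_superset: "F \<subseteq> edge_span F"
  unfolding edge_span_def conn_def by auto

lemma edge_span_mono: "F \<subseteq> F' \<Longrightarrow> edge_span F \<subseteq> edge_span F'"
  using conn_mono unfolding edge_span_def by blast

text \<open>Each edge of a walk in \<open>F\<close> can be replaced by a walk in \<open>F'\<close>.
  This is what makes the span idempotent.\<close>

lemma conn_subset_conn_of_edge_span:
  assumes "F \<subseteq> edge_span F'"
  shows "conn F \<subseteq> conn F'"
proof -
  have "{(x, y). {x, y} \<in> F} \<subseteq> conn F'"
    using assms by (auto simp flip: doubleton_in_edge_span)
  then have "conn F \<subseteq> (conn F')\<^sup>*" unfolding conn_def by (rule rtrancl_mono)
  then show ?thesis by (simp add: conn_def)
qed

lemma edge_span_subset: "F \<subseteq> edge_span F' \<Longrightarrow> edge_span F \<subseteq> edge_span F'"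
  using conn_subset_conn_of_edge_span unfolding edge_span_def by blast

text \<open>A walk that crosses the edge from \<open>a\<close> to \<open>b\<close> repeatedly can be
  shortened until it crosses at most once; the last two alternatives are the two directions of that
  crossing.\<close>

lemma conn_insert:
  assumes "(x, y) \<in> conn (insert {a, b} F)"
  shows "(x, y) \<in> conn F \<or> (x, a) \<in> conn F \<and> (b, y) \<in> conn F \<or> (x, b) \<in> conn F \<and> (a, y) \<in> conn F"
  using assms unfolding conn_def[of "insert {a, b} F"]
proof (induction rule: rtrancl_induct)
  case base
  then show ?case by (simp add: conn_def)
next
  case (step y z)
  then have "{y, z} \<in> F \<or> y = a \<and> z = b \<or> y = b \<and> z = a"
    by (auto simp: doubleton_eq_iff)
  moreover have "(w, w) \<in> conn F" for w by (simp add: conn_def)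
  moreover have "(y, z) \<in> conn F" if "{y, z} \<in> F" using that by (auto simp: conn_def)
  ultimately show ?case using step.IH by (metis conn_trans conn_sym)
qed

text \<open>The exchange axiom of matroids. The ends of \<open>f\<close> are joined with the help of
  \<open>e\<close> but not without it, so the walk crosses \<open>e\<close> exactly once after
  shortening. Its two outer sections together with \<open>f\<close> form a detour between the ends
  of \<open>e\<close>.\<close>

lemma edge_span_exchange:
  assumes "f \<in> edge_span (insert e F)" "f \<notin> edge_span F"
  shows "e \<in> edge_span (insert f F)"
proof -
  from assms(2) obtain x y where f: "f = {x, y}" and nxy: "(x, y) \<notin> conn F"
    unfolding edge_span_def by auto
  have xy: "(x, y) \<in> conn (insert e F)" using assms(1) f doubleton_in_edge_span by metis
  show ?thesis unfolding edge_span_def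
  proof (clarify)
    fix a b assume e: "e = {a, b}"
    have sub: "conn F \<subseteq> conn (insert f F)" by (intro conn_mono) auto
    have "(x, y) \<in> conn (insert f F)" unfolding conn_def f by auto
    then show "(a, b) \<in> conn (insert f F)"
      using conn_insert[of x y a b F] xy nxy sub e by (meson conn_sym conn_trans subsetD)
  qed
qed

section \<open>Effect of added edges on the number of bases\<close>

lemma bases_subset: "F \<in> bases E \<Longrightarrow> F \<subseteq> E"
  by (simp add: bases_def)

lemma finite_bases: "finite E \<Longrightarrow> finite (bases E)"
  by (rule finite_subset[of _ "Pow E"]) (auto simp: bases_def)

text \<open>If \<open>e\<close> is already spanned by \<open>E\<close>, the old bases stay bases.
  Otherwise \<open>e\<close> is a bridge, and adding it to every old basis is an injection.\<close>

lemma card_bases_le_insert: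
  assumes "finite E"
  shows "card (bases E) \<le> card (bases (insert e E))"
proof (cases "e \<in> edge_span E")
  case True
  have "bases E \<subseteq> bases (insert e E)"
  proof
    fix F assume F: "F \<in> bases E"
    then have "edge_span E \<subseteq> edge_span F" by (intro edge_span_subset) (simp add: bases_def)
    with F True show "F \<in> bases (insert e E)" by (auto simp: bases_def)
  qed
  with assms show ?thesis by (intro card_mono finite_bases) auto
next
  case False
  have eE: "e \<notin> E" using False edge_span_superset by blast
  show ?thesis
  proof (rule card_inj_on_le)
    show "inj_on (insert e) (bases E)"
      using eE by (intro inj_onI) (auto simp: bases_def)
    show "insert e ` bases E \<subseteq> bases (insert e E)"
    proof (rule image_subsetI)
      fix F assume F: "F \<in> bases E"
      then have FE: "F \<subseteq> E" and sp: "E \<subseteq> edge_span F" and ind: "\<And>f. f \<in> F \<Longrightarrow> f \<notin> edge_span (F - {f})"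
        by (auto simp: bases_def)
      have eF: "e \<notin> edge_span F" using edge_span_mono[OF FE] False by auto
      have "insert e E \<subseteq> edge_span (insert e F)"
        using sp edge_span_mono[of F "insert e F"] edge_span_superset[of "insert e F"] by blast
      moreover have "insert e F - {e} = F" using eE FE by auto
      \<comment> \<open>Since \<open>F\<close> is independent, a dependence of \<open>f\<close>
        would have to involve \<open>e\<close>; exchanging the two would place \<open>e\<close> in
        the span of \<open>F\<close>.\<close>
      moreover have "f \<notin> edge_span (insert e F - {f})" if f: "f \<in> F" for f
      proof
        assume *: "f \<in> edge_span (insert e F - {f})"
        have "insert e F - {f} = insert e (F - {f})" using f eE FE by auto
        with * have "e \<in> edge_span (insert f (F - {f}))"
          using ind[OF f] edge_span_exchange[of f e "F - {f}"] by simp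
        with f eF show False by (simp add: insert_absorb)
      qed
      ultimately show "insert e F \<in> bases (insert e E)"
        using FE eF by (auto simp: bases_def)
    qed
    show "finite (bases (insert e E))" using assms by (intro finite_bases) auto
  qed
qed

text \<open>Any \<open>f\<close> in \<open>E\<close> outside the span of \<open>T - {e}\<close> will
  do: by exchange it recovers \<open>e\<close>, hence everything that \<open>T\<close>
  spans.\<close>

lemma basis_exchange:
  assumes T: "T \<in> bases (insert e E)" and e: "e \<in> T" and nb: "T - {e} \<notin> bases E"
  obtains f where "f \<in> E" "f \<notin> T - {e}" "insert f (T - {e}) \<in> bases E"
proof -
  define T' where "T' = T - {e}"
  have T_eq: "T = insert e T'" using e by (auto simp: T'_def)
  have T'E: "T' \<subseteq> E" and sp: "insert e E \<subseteq> edge_span (insert e T')" and eT': "e \<notin> edge_span T'"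
    using T e unfolding T_eq[symmetric] by (auto simp: bases_def T'_def)
  have ind: "g \<notin> edge_span (T' - {g})" if "g \<in> T'" for g
  proof -
    have "g \<notin> edge_span (T - {g})" using T that by (auto simp: bases_def T'_def)
    moreover have "edge_span (T' - {g}) \<subseteq> edge_span (T - {g})" by (intro edge_span_mono) (auto simp: T'_def)
    ultimately show ?thesis by blast
  qed
  \<comment> \<open>Independence survives the deletion of \<open>e\<close>, so the only way to fail
    to be a basis is to fail to span.\<close>
  have "\<not> E \<subseteq> edge_span T'" using nb T'E ind by (auto simp: bases_def T'_def)
  then obtain f where f: "f \<in> E" "f \<notin> edge_span T'" by blast
  have fT': "f \<notin> T'" using f edge_span_superset by blast
  have "e \<in> edge_span (insert f T')" using f sp by (blast intro: edge_span_exchange[of f e T'])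
  then have "insert e T' \<subseteq> edge_span (insert f T')" using edge_span_superset[of "insert f T'"] by blast
  then have "edge_span (insert e T') \<subseteq> edge_span (insert f T')" by (rule edge_span_subset)
  with sp have "E \<subseteq> edge_span (insert f T')" by blast
  moreover have "g \<notin> edge_span (insert f T' - {g})" if g: "g \<in> T'" for g
  proof
    assume *: "g \<in> edge_span (insert f T' - {g})"
    have "insert f T' - {g} = insert f (T' - {g})" using g fT' by auto
    with * have "f \<in> edge_span (insert g (T' - {g}))"
      using ind[OF g] edge_span_exchange[of g f "T' - {g}"] by simp
    with g f show False by (simp add: insert_absorb)
  qed
  moreover have "insert f T' - {f} = T'" using fT' by auto
  ultimately have "insert f T' \<in> bases E" using f T'E by (auto simp: bases_def)
  with f fT' show ?thesis by (intro that[of f]) (auto simp: T'_def)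
qed

lemma card_bases_insert_le:
  assumes "finite E"
  shows "card (bases (insert e E)) \<le> card (bases E) * (1 + card (insert e E))"
proof (cases "e \<in> E")
  case False
  \<comment> \<open>\<open>X\<close> undoes the exchange: it drops \<open>f\<close> from a basis
    \<open>S\<close> of \<open>E\<close> and puts \<open>e\<close> back. Letting \<open>f\<close>
    range over \<open>insert e E\<close> admits \<open>f = e\<close>, the case of mere deletion. The
    summand 1 in the bound pays for the bases that avoid \<open>e\<close>.\<close>
  define X where "X = (\<lambda>(S, f). insert e (S - {f})) ` (bases E \<times> insert e E)"
  have "T \<in> bases E \<union> X" if T: "T \<in> bases (insert e E)" for T
  proof (cases "e \<in> T")
    case False
    with T show ?thesis by (auto simp: bases_def)
  next
    case e: True
    show ?thesis
    proof (cases "T - {e} \<in> bases E")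
      case True
      moreover have "T = insert e (T - {e} - {e})" using e by auto
      ultimately show ?thesis unfolding X_def by (intro UnI2 image_eqI[of _ _ "(T - {e}, e)"]) auto
    next
      case nb: False
      with T e obtain f where f: "f \<in> E" "f \<notin> T - {e}" "insert f (T - {e}) \<in> bases E"
        by (rule basis_exchange)
      moreover have "T = insert e (insert f (T - {e}) - {f})" using e f by auto
      ultimately show ?thesis unfolding X_def by (intro UnI2 image_eqI[of _ _ "(insert f (T - {e}), f)"]) auto
    qed
  qed
  then have "card (bases (insert e E)) \<le> card (bases E \<union> X)"
    using assms finite_bases[OF assms] by (intro card_mono) (auto simp: X_def)
  also have "\<dots> \<le> card (bases E) + card X" by (rule card_Un_le)
  also have "card X \<le> card (bases E \<times> insert e E)"
    using assms finite_bases[OF assms] unfolding X_def by (intro card_image_le) auto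
  finally show ?thesis by (simp add: card_cartesian_product)
qed (simp add: insert_absorb)

lemma card_bases_mono_Un:
  assumes "finite E" "finite D"
  shows "card (bases E) \<le> card (bases (E \<union> D))"
  using assms(2)
proof (induction D)
  case (insert e D)
  then show ?case using card_bases_le_insert[of "E \<union> D" e] assms(1) by simp
qed simp

text \<open>All intermediate edge sets lie inside \<open>E \<union> D\<close>, so the single
  constant \<open>K\<close> bounds the factor of every insertion.\<close>

lemma card_bases_Un_le:
  assumes "finite E" "finite D" "1 + card (E \<union> D) \<le> K"
  shows "card (bases (E \<union> D)) \<le> card (bases E) * K ^ card D"
  using assms(2,3)
proof (induction D)
  case (insert e D)
  have fin: "finite (E \<union> D)" using insert assms(1) by simp
  have "card (E \<union> D) \<le> card (E \<union> insert e D)" using insert assms(1) by (intro card_mono) auto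
  then have IH: "card (bases (E \<union> D)) \<le> card (bases E) * K ^ card D" using insert by simp
  have "card (bases (E \<union> insert e D)) \<le> card (bases (E \<union> D)) * (1 + card (E \<union> insert e D))"
    using card_bases_insert_le[OF fin, of e] by simp
  also have "\<dots> \<le> card (bases E) * K ^ card D * K"
    using IH insert.prems by (intro mult_mono) auto
  finally show ?case using insert by (simp add: mult_ac)
qed simp

section \<open>Factorization over disjoint vertex sets\<close>

text \<open>Every edge of \<open>F\<close> lies within one side, so a walk that starts in
  \<open>A\<close> never leaves it and uses only edges inside \<open>A\<close>.\<close>

lemma in_edge_span_Int_Pow_iff:
  assumes "F \<subseteq> Pow A \<union> Pow B" "A \<inter> B = {}" "e \<subseteq> A"
  shows "e \<in> edge_span F \<longleftrightarrow> e \<in> edge_span (F \<inter> Pow A)"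
proof
  assume e: "e \<in> edge_span F"
  show "e \<in> edge_span (F \<inter> Pow A)" unfolding edge_span_def
  proof clarify
    fix x y assume xy: "e = {x, y}"
    then have "(x, y) \<in> {(x, y). {x, y} \<in> F}\<^sup>*" using e by (simp add: doubleton_in_edge_span conn_def)
    then have "y \<in> A \<and> (x, y) \<in> conn (F \<inter> Pow A)"
    proof (induction rule: rtrancl_induct)
      case base
      then show ?case using xy assms by (simp add: conn_def)
    next
      case (step y z)
      then have "{y, z} \<in> F \<inter> Pow A" using assms by auto
      then have "z \<in> A" "(y, z) \<in> conn (F \<inter> Pow A)" by (auto simp: conn_def)
      then show ?case using step.IH conn_trans by metis
    qed
    then show "(x, y) \<in> conn (F \<inter> Pow A)" by simp
  qed
next
  show "e \<in> edge_span (F \<inter> Pow A) \<Longrightarrow> e \<in> edge_span F" using edge_span_mono[of "F \<inter> Pow A" F] by auto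
qed

text \<open>Spanning and independence are both conditions on single edges, and whether an edge is
  spanned depends only on the edges of its own side.\<close>

lemma in_bases_split_iff:
  assumes E: "E \<subseteq> Pow A \<union> Pow B" and AB: "A \<inter> B = {}" and F: "F \<subseteq> E"
  shows "F \<in> bases E \<longleftrightarrow> F \<inter> Pow A \<in> bases (E \<inter> Pow A) \<and> F \<inter> Pow B \<in> bases (E \<inter> Pow B)"
proof -
  have FA: "F \<subseteq> Pow A \<union> Pow B" and FB: "F \<subseteq> Pow B \<union> Pow A" and BA: "B \<inter> A = {}"
    using assms by auto
  have sp: "E \<subseteq> edge_span F \<longleftrightarrow>
      E \<inter> Pow A \<subseteq> edge_span (F \<inter> Pow A) \<and> E \<inter> Pow B \<subseteq> edge_span (F \<inter> Pow B)"
    (is "?L \<longleftrightarrow> ?R")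
  proof
    show "?L \<Longrightarrow> ?R"
      using in_edge_span_Int_Pow_iff[OF FA AB] in_edge_span_Int_Pow_iff[OF FB BA] by auto
    assume R: ?R
    show ?L
    proof
      fix e assume "e \<in> E"
      with E R consider "e \<subseteq> A" "e \<in> edge_span (F \<inter> Pow A)" | "e \<subseteq> B" "e \<in> edge_span (F \<inter> Pow B)"
        by blast
      then show "e \<in> edge_span F"
        using in_edge_span_Int_Pow_iff[OF FA AB] in_edge_span_Int_Pow_iff[OF FB BA] by cases auto
    qed
  qed
  have "e \<in> edge_span (F - {e}) \<longleftrightarrow> e \<in> edge_span (F \<inter> Pow A - {e})" if "e \<subseteq> A" for e
    using in_edge_span_Int_Pow_iff[of "F - {e}" A B e] FA AB that by (auto simp: Int_Diff Diff_Int_distrib2)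
  moreover have "e \<in> edge_span (F - {e}) \<longleftrightarrow> e \<in> edge_span (F \<inter> Pow B - {e})" if "e \<subseteq> B" for e
    using in_edge_span_Int_Pow_iff[of "F - {e}" B A e] FB BA that by (auto simp: Int_Diff Diff_Int_distrib2)
  ultimately have "(\<forall>e\<in>F. e \<notin> edge_span (F - {e})) \<longleftrightarrow>
      (\<forall>e\<in>F \<inter> Pow A. e \<notin> edge_span (F \<inter> Pow A - {e})) \<and> (\<forall>e\<in>F \<inter> Pow B. e \<notin> edge_span (F \<inter> Pow B - {e}))"
    using FA by blast
  with sp F show ?thesis unfolding bases_def by auto
qed

lemma card_bases_split:
  assumes E: "E \<subseteq> Pow A \<union> Pow B" and AB: "A \<inter> B = {}" and ne: "{} \<notin> E"
  shows "card (bases E) = card (bases (E \<inter> Pow A)) * card (bases (E \<inter> Pow B))"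
proof -
  have "bij_betw (\<lambda>F. (F \<inter> Pow A, F \<inter> Pow B)) (bases E) (bases (E \<inter> Pow A) \<times> bases (E \<inter> Pow B))"
  proof (rule bij_betw_byWitness[where f' = "\<lambda>(X, Y). X \<union> Y"])
    show "\<forall>F\<in>bases E. (case (F \<inter> Pow A, F \<inter> Pow B) of (X, Y) \<Rightarrow> X \<union> Y) = F"
      using E by (auto simp: bases_def)
    have split: "(X \<union> Y) \<inter> Pow A = X \<and> (X \<union> Y) \<inter> Pow B = Y \<and> X \<union> Y \<subseteq> E"
      if "X \<in> bases (E \<inter> Pow A)" "Y \<in> bases (E \<inter> Pow B)" for X Y
    proof -
      have XY: "X \<subseteq> E \<inter> Pow A" "Y \<subseteq> E \<inter> Pow B" using that by (auto simp: bases_def)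
      \<comment> \<open>The empty set is the only common member of \<open>Pow A\<close> and
        \<open>Pow B\<close>. As \<open>ne\<close> keeps it out of \<open>E\<close>, the two parts
        can be read off from their union.\<close>
      have "e = {}" if "e \<in> Pow A \<inter> Pow B" for e using that AB by auto
      with XY ne have "X \<inter> Pow B = {}" "Y \<inter> Pow A = {}" by blast+
      with XY show ?thesis by blast
    qed
    then show "\<forall>p\<in>bases (E \<inter> Pow A) \<times> bases (E \<inter> Pow B).
        ((case p of (X, Y) \<Rightarrow> X \<union> Y) \<inter> Pow A, (case p of (X, Y) \<Rightarrow> X \<union> Y) \<inter> Pow B) = p"
      by auto
    show "(\<lambda>F. (F \<inter> Pow A, F \<inter> Pow B)) ` bases E \<subseteq> bases (E \<inter> Pow A) \<times> bases (E \<inter> Pow B)"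
      using in_bases_split_iff[OF E AB] bases_subset by blast
    show "(\<lambda>(X, Y). X \<union> Y) ` (bases (E \<inter> Pow A) \<times> bases (E \<inter> Pow B)) \<subseteq> bases E"
      using in_bases_split_iff[OF E AB] split by auto
  qed
  then show ?thesis by (simp add: bij_betw_same_card card_cartesian_product)
qed

lemma card_bases_prod:
  assumes "finite I" "disjoint_family_on A I" "E \<subseteq> (\<Union>i\<in>I. Pow (A i))" "{} \<notin> E"
  shows "card (bases E) = (\<Prod>i\<in>I. card (bases (E \<inter> Pow (A i))))"
  using assms
proof (induction I arbitrary: E)
  case empty
  then have "bases E = {{}}" by (auto simp: bases_def)
  then show ?case by simp
next
  case (insert j I)
  define B where "B = (\<Union>i\<in>I. A i)"
  have AB: "A j \<inter> B = {}"
    using insert.prems(1) insert.hyps by (auto simp: B_def disjoint_family_on_def)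
  \<comment> \<open>\<open>Pow B\<close> also contains sets that meet several \<open>A i\<close>. An
    edge of \<open>E\<close> lies in a single block, and being nonempty and inside \<open>B\<close>
    it cannot have \<open>A j\<close> as that block.\<close>
  have "E \<inter> Pow B \<subseteq> (\<Union>i\<in>I. Pow (A i))"
  proof
    fix e assume e: "e \<in> E \<inter> Pow B"
    then have "e \<noteq> {}" using insert.prems by auto
    with e AB have "\<not> e \<subseteq> A j" by blast
    with e insert.prems show "e \<in> (\<Union>i\<in>I. Pow (A i))" by auto
  qed
  moreover have "disjoint_family_on A I"
    using insert.prems(1) by (auto simp: disjoint_family_on_def)
  ultimately have "card (bases (E \<inter> Pow B)) = (\<Prod>i\<in>I. card (bases (E \<inter> Pow B \<inter> Pow (A i))))"
    using insert.IH insert.prems by blast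
  also have "\<dots> = (\<Prod>i\<in>I. card (bases (E \<inter> Pow (A i))))"
  proof (rule prod.cong)
    fix i assume "i \<in> I"
    then have "Pow B \<inter> Pow (A i) = Pow (A i)" by (auto simp: B_def)
    then show "card (bases (E \<inter> Pow B \<inter> Pow (A i))) = card (bases (E \<inter> Pow (A i)))"
      by (simp add: Int_assoc)
  qed simp
  moreover have "E \<subseteq> Pow (A j) \<union> Pow B" using insert.prems by (auto simp: B_def)
  ultimately show ?case using card_bases_split[of E "A j" B] AB insert by simp
qed

section \<open>Spanning trees as bases\<close>

lemma conn_of_successively:
  assumes "p \<noteq> []" "successively (\<lambda>x y. {x, y} \<in> F) p"
  shows "(hd p, last p) \<in> conn F"
  using assms
proof (induction p)
  case (Cons a p)
  show ?case
  proof (cases "p = []")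
    case False
    with Cons.prems have "{a, hd p} \<in> F" "(hd p, last p) \<in> conn F"
      using Cons.IH by (auto simp: successively_Cons)
    moreover from this have "(a, hd p) \<in> conn F" by (auto simp: conn_def)
    ultimately show ?thesis using False conn_trans by fastforce
  qed (simp add: conn_def)
qed simp

lemma path_of_conn:
  assumes "(u, v) \<in> conn F" "u \<in> W" "F \<subseteq> Pow W"
  shows "\<exists>p. path_between (W, F) u v p"
proof -
  have "{(x, y). {x, y} \<in> F} = {(x, y). x \<in> W \<and> y \<in> W \<and> {x, y} \<in> edges (W, F)}"
    using assms(3) by auto
  with assms path_between_of_rtrancl[of u v W "(W, F)"] show ?thesis by (auto simp: conn_def)
qed

lemma conn_of_path:
  assumes "path_between G u v p" "set p \<subseteq> W"
  shows "(u, v) \<in> conn (edges G \<inter> Pow W)"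
proof -
  have "successively (\<lambda>x y. {x, y} \<in> edges G) p"
    using assms by (simp add: path_between_def)
  then have "successively (\<lambda>x y. {x, y} \<in> edges G \<inter> Pow W) p"
    by (rule successively_mono) (use assms in auto)
  with assms show ?thesis using conn_of_successively[of p] by (auto simp: path_between_def)
qed

text \<open>A cycle through \<open>e\<close> is the same as a path in \<open>F - {e}\<close> between
  the ends of \<open>e\<close>, closed up by \<open>e\<close>.\<close>

lemma acyclic_iff:
  assumes F: "F \<subseteq> Pow W" and card: "\<And>e. e \<in> F \<Longrightarrow> card e = 2"
  shows "(\<nexists>p. cycle (W, F) p) \<longleftrightarrow> (\<forall>e\<in>F. e \<notin> edge_span (F - {e}))"
proof
  assume nc: "\<nexists>p. cycle (W, F) p"
  show "\<forall>e\<in>F. e \<notin> edge_span (F - {e})"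
  proof (intro ballI notI)
    fix e assume e: "e \<in> F" "e \<in> edge_span (F - {e})"
    then obtain x y where xy: "e = {x, y}" "x \<noteq> y" using card by (meson card_2_iff)
    then have "(x, y) \<in> conn (F - {e})" using e(2) by (simp add: doubleton_in_edge_span)
    moreover have "x \<in> W" "F - {e} \<subseteq> Pow W" using e(1) xy F by auto
    ultimately obtain p where p: "path_between (W, F - {e}) x y p"
      using path_of_conn by metis
    then have "successively (\<lambda>x y. {x, y} \<in> F - {e}) p" by (simp add: path_between_def)
    then have succ: "successively (\<lambda>x y. {x, y} \<in> F) p" by (rule successively_mono) auto
    \<comment> \<open>A path on one vertex would force \<open>x = y\<close>, and a path on two
      vertices would use the removed edge \<open>e\<close>.\<close>
    have "3 \<le> length p"
    proof (rule ccontr)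
      assume "\<not> 3 \<le> length p"
      then have "length p = 0 \<or> length p = Suc 0 \<or> length p = Suc (Suc 0)" by linarith
      then show False using p xy by (auto simp: path_between_def length_Suc_conv)
    qed
    with p succ xy e have "cycle (W, F) p"
      by (auto simp: cycle_def path_between_def insert_commute)
    with nc show False by blast
  qed
next
  assume ind: "\<forall>e\<in>F. e \<notin> edge_span (F - {e})"
  show "\<nexists>p. cycle (W, F) p"
  proof
    assume "\<exists>p. cycle (W, F) p"
    then obtain p where p: "3 \<le> length p" "distinct p" "successively (\<lambda>x y. {x, y} \<in> F) p"
        "{last p, hd p} \<in> F" by (auto simp: cycle_def)
    have ne: "p \<noteq> []" using p by auto
    \<comment> \<open>The path does not use the closing edge: by distinctness a consecutive pair
      equal to it would have the first and last positions as its indices, which are not adjacent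
      when the length is at least 3.\<close>
    have "successively (\<lambda>x y. {x, y} \<in> F - {{last p, hd p}}) p"
      unfolding successively_conv_nth
    proof (intro allI impI)
      fix i assume i: "Suc i < length p"
      have "p ! i = last p \<longleftrightarrow> i = length p - 1" "p ! Suc i = last p \<longleftrightarrow> Suc i = length p - 1"
          "p ! i = hd p \<longleftrightarrow> i = 0" "p ! Suc i = hd p \<longleftrightarrow> Suc i = 0"
        using ne i p(2) by (auto simp: last_conv_nth hd_conv_nth nth_eq_iff_index_eq)
      then have "{p ! i, p ! Suc i} \<noteq> {last p, hd p}" using i p(1) by (auto simp: doubleton_eq_iff)
      then show "{p ! i, p ! Suc i} \<in> F - {{last p, hd p}}"
        using p(3) i by (simp add: successively_conv_nth)
    qed
    then have "(hd p, last p) \<in> conn (F - {{last p, hd p}})" using ne conn_of_successively by blast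
    then have "{last p, hd p} \<in> edge_span (F - {{last p, hd p}})"
      by (simp add: doubleton_in_edge_span conn_sym)
    with ind p(4) show False by blast
  qed
qed

text \<open>Acyclicity is independence. Since \<open>W\<close> is connected in \<open>G\<close>,
  connectedness of \<open>(W, F)\<close> amounts to spanning: a path of \<open>G\<close> inside
  \<open>W\<close> is rerouted through \<open>F\<close> edge by edge.\<close>

lemma spanning_trees_eq_bases:
  assumes G: "finite_ugraph G" and W: "connected_set G W"
  shows "spanning_trees G W = bases (edges G \<inter> Pow W)"
proof -
  have "tree (W, F) \<longleftrightarrow> edges G \<inter> Pow W \<subseteq> edge_span F \<and> (\<forall>e\<in>F. e \<notin> edge_span (F - {e}))"
    if F: "F \<subseteq> edges G \<inter> Pow W" for F
  proof -
    have FW: "F \<subseteq> Pow W" and card: "\<And>e. e \<in> F \<Longrightarrow> card e = 2"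
      using F G by (auto simp: finite_ugraph_def)
    have "connected_set (W, F) W \<longleftrightarrow> edges G \<inter> Pow W \<subseteq> edge_span F"
    proof
      assume c: "connected_set (W, F) W"
      show "edges G \<inter> Pow W \<subseteq> edge_span F"
      proof
        fix e assume e: "e \<in> edges G \<inter> Pow W"
        show "e \<in> edge_span F" unfolding edge_span_def
        proof clarify
          fix x y assume "e = {x, y}"
          with e have "x \<in> W" "y \<in> W" by auto
          with c obtain p where "path_between (W, F) x y p" "set p \<subseteq> W"
            unfolding connected_set_def by blast
          then have "(x, y) \<in> conn (F \<inter> Pow W)" using conn_of_path by fastforce
          with FW show "(x, y) \<in> conn F" by (simp add: Int_absorb2)
        qed
      qed
    next
      assume sp: "edges G \<inter> Pow W \<subseteq> edge_span F"
      have "\<exists>p. path_between (W, F) u v p \<and> set p \<subseteq> W" if uv: "u \<in> W" "v \<in> W" for u v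
      proof -
        from W uv obtain p where "path_between G u v p" "set p \<subseteq> W"
          unfolding connected_set_def by blast
        then have "(u, v) \<in> conn F"
          using conn_of_path conn_subset_conn_of_edge_span[OF sp] by fastforce
        with uv FW path_of_conn obtain q where "path_between (W, F) u v q" by metis
        then show ?thesis by (auto simp: path_between_def)
      qed
      with W show "connected_set (W, F) W" by (auto simp: connected_set_def)
    qed
    with acyclic_iff[OF FW card] show ?thesis by (simp add: tree_def)
  qed
  moreover have "{e \<in> edges G. e \<subseteq> W} = edges G \<inter> Pow W" by auto
  ultimately show ?thesis unfolding spanning_trees_def bases_def by auto
qed

text \<open>Distinct components have distance greater than 1, so no edge joins them and every edge
  inside \<open>W\<close> lies in one component. The number of bases therefore factors exactly as
  \<open>num_spanning\<close> does.\<close>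

lemma num_spanning_eq_card_bases:
  assumes G: "finite_ugraph G" and W: "W \<subseteq> vertices G"
  shows "num_spanning G W = card (bases (edges G \<inter> Pow W))"
proof -
  define P where "P = (THE P. connected_decomposition G W P)"
  have P: "connected_decomposition G W P"
    unfolding P_def by (rule theI') (rule ex1_connected_decomposition[OF G W])
  have conn: "connected_set G A" "A \<subseteq> W" if "A \<in> P" for A
    using P that by (auto simp: connected_decomposition_def)
  have "finite W" using G W by (auto simp: finite_ugraph_def intro: finite_subset)
  moreover have "P \<subseteq> Pow W" using conn by auto
  ultimately have fin: "finite P" by (auto intro: finite_subset)
  have eq: "A = B" if "A \<in> P" "B \<in> P" "a \<in> A" "a \<in> B" for A B a
    using connected_decomposition_absorbs[OF G P] conn that by (meson subset_antisym)
  have disj: "disjoint_family_on (\<lambda>A. A) P"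
    using eq by (auto simp: disjoint_family_on_def)
  have sub: "edges G \<inter> Pow W \<subseteq> (\<Union>A\<in>P. Pow A)"
  proof
    fix e assume e: "e \<in> edges G \<inter> Pow W"
    then have "card e = 2" using G by (auto simp: finite_ugraph_def)
    then obtain x y where xy: "e = {x, y}" "x \<noteq> y" by (meson card_2_iff)
    with e P obtain A B where AB: "A \<in> P" "B \<in> P" "x \<in> A" "y \<in> B"
      by (auto simp: connected_decomposition_def)
    have "set_dist G A B \<le> 1" using xy e AB W by (intro set_dist_le_1[of x y]) auto
    with P AB have "A = B" unfolding connected_decomposition_def by (metis leD)
    with AB xy show "e \<in> (\<Union>A\<in>P. Pow A)" by auto
  qed
  have "{} \<notin> edges G \<inter> Pow W" using G by (auto simp: finite_ugraph_def)
  from card_bases_prod[OF fin disj sub this]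
  have "card (bases (edges G \<inter> Pow W)) = (\<Prod>A\<in>P. card (bases (edges G \<inter> Pow W \<inter> Pow A)))" .
  also have "\<dots> = (\<Prod>A\<in>P. card (spanning_trees G A))"
  proof (rule prod.cong)
    fix A assume A: "A \<in> P"
    then have "Pow W \<inter> Pow A = Pow A" using conn by auto
    then show "card (bases (edges G \<inter> Pow W \<inter> Pow A)) = card (spanning_trees G A)"
      using spanning_trees_eq_bases[OF G conn(1)[OF A]] by (simp add: Int_assoc)
  qed simp
  finally show ?thesis by (simp add: num_spanning_def P_def)
qed

section \<open>Edge counts and the two bounds\<close>

lemma card_edges_in_le:
  assumes "finite W" "\<And>e. e \<in> E \<Longrightarrow> e \<subseteq> W \<and> card e = 2"
  shows "card E \<le> card W ^ 2"
proof -
  have "E \<subseteq> (\<lambda>(x, y). {x, y}) ` (W \<times> W)"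
  proof
    fix e assume e: "e \<in> E"
    then obtain x y where "e = {x, y}" using assms(2) by (meson card_2_iff)
    then show "e \<in> (\<lambda>(x, y). {x, y}) ` (W \<times> W)" using assms(2)[OF e] by force
  qed
  then have "card E \<le> card (W \<times> W)" using assms(1) by (intro surj_card_le) auto
  then show ?thesis by (simp add: card_cartesian_product power2_eq_square)
qed

text \<open>An edge inside no single \<open>V i\<close> has its ends in sets with different indices;
  swapping the ends if necessary puts the smaller index first. The rest is a union bound.\<close>

lemma card_crossing_edges_le:
  assumes "finite_ugraph G"
  shows "card (edges G \<inter> Pow (\<Union>i\<in>{1..m}. V i) - (\<Union>i\<in>{1..m}. Pow (V i)))
    \<le> total_edges_between G m V"
proof -
  let ?C = "\<lambda>i i'. {e \<in> edges G. \<exists>u\<in>V i. \<exists>v\<in>V i'. e = {u, v}}"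
  have "edges G \<subseteq> Pow (vertices G)" "finite (vertices G)"
    using assms by (auto simp: finite_ugraph_def)
  then have fin: "finite (edges G)" by (meson finite_Pow_iff finite_subset)
  have "edges G \<inter> Pow (\<Union>i\<in>{1..m}. V i) - (\<Union>i\<in>{1..m}. Pow (V i))
    \<subseteq> (\<Union>i\<in>{1..m}. \<Union>i'\<in>{i+1..m}. ?C i i')" (is "?D \<subseteq> ?U")
  proof
    fix e assume e: "e \<in> ?D"
    then have "card e = 2" using assms by (auto simp: finite_ugraph_def)
    then obtain x y where xy: "e = {x, y}" by (meson card_2_iff)
    with e obtain i j where ij: "i \<in> {1..m}" "j \<in> {1..m}" "x \<in> V i" "y \<in> V j" by auto
    with e xy have "i \<noteq> j" by auto
    then consider "i < j" | "j < i" by linarith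
    then show "e \<in> ?U"
    proof cases
      case 1
      with ij e xy have "e \<in> ?C i j" "j \<in> {i+1..m}" by auto
      with ij(1) show ?thesis by blast
    next
      case 2
      with ij e xy have "e \<in> ?C j i" "i \<in> {j+1..m}" by (auto simp: insert_commute)
      with ij(2) show ?thesis by blast
    qed
  qed
  then have "card ?D \<le> card ?U" using fin by (intro card_mono) auto
  also have "\<dots> \<le> (\<Sum>i=1..m. card (\<Union>i'\<in>{i+1..m}. ?C i i'))" by (intro card_UN_le) simp
  also have "\<dots> \<le> (\<Sum>i=1..m. \<Sum>i'=i+1..m. card (?C i i'))"
    by (intro sum_mono card_UN_le) simp
  finally show ?thesis by (simp add: total_edges_between_def edges_between_def)
qed

theorem lemmaS23:
  fixes G :: "'a ugraph" and m :: nat and V :: "nat \<Rightarrow> 'a set"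
  assumes "finite_ugraph G"
    and "\<And>i. i \<in> {1..m} \<Longrightarrow> connected_set G (V i)"
    and "\<And>i i'. i \<in> {1..m} \<Longrightarrow> i' \<in> {1..m} \<Longrightarrow> i \<noteq> i' \<Longrightarrow> V i \<inter> V i' = {}"
  shows "(\<Prod>i=1..m. num_spanning G (V i)) \<le> num_spanning G (\<Union>i\<in>{1..m}. V i)
    \<and> real (num_spanning G (\<Union>i\<in>{1..m}. V i))
      \<le> real (\<Prod>i=1..m. num_spanning G (V i))
        * exp (real (total_edges_between G m V)
               * (2 * ln (real (\<Sum>i=1..m. card (V i))) + ln 2))"
proof -
  note G = assms(1)
  define W where "W = (\<Union>i\<in>{1..m}. V i)"
  \<comment> \<open>\<open>E\<close> collects the edges inside some \<open>V i\<close> and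
    \<open>D\<close> the crossing edges. The bases of \<open>E\<close> give the product, those of
    \<open>E \<union> D\<close> give the count for the whole union.\<close>
  define E where "E = edges G \<inter> (\<Union>i\<in>{1..m}. Pow (V i))"
  define D where "D = edges G \<inter> Pow W - (\<Union>i\<in>{1..m}. Pow (V i))"
  define b where "b = total_edges_between G m V"
  define n where "n = (\<Sum>i=1..m. card (V i))"
  have VG: "V i \<subseteq> vertices G" "V i \<noteq> {}" if "i \<in> {1..m}" for i
    using assms(2)[OF that] by (auto simp: connected_set_def)
  then have WG: "W \<subseteq> vertices G" by (fastforce simp: W_def)
  have finW: "finite W" using G WG by (auto simp: finite_ugraph_def intro: finite_subset)
  then have finV: "finite (V i)" if "i \<in> {1..m}" for i
    using that by (intro finite_subset[OF _ finW]) (auto simp: W_def)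
  have n_eq: "n = card W"
    unfolding n_def W_def using finV assms(3) by (intro card_UN_disjoint[symmetric]) auto
  have ED: "edges G \<inter> Pow W = E \<union> D" by (auto simp: E_def D_def W_def)
  then have edge: "e \<subseteq> W \<and> card e = 2" if "e \<in> E \<union> D" for e
    using that G by (auto simp: finite_ugraph_def)
  have fin: "finite E" "finite D"
    using finW edge by (auto intro: finite_subset[of _ "Pow W"])
  have upper: "num_spanning G W = card (bases (E \<union> D))"
    using num_spanning_eq_card_bases[OF G WG] ED by simp
  have "disjoint_family_on V {1..m}" using assms(3) by (auto simp: disjoint_family_on_def)
  moreover have "{} \<notin> E" using G by (auto simp: E_def finite_ugraph_def)
  ultimately have "card (bases E) = (\<Prod>i=1..m. card (bases (E \<inter> Pow (V i))))"
    by (intro card_bases_prod) (auto simp: E_def)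
  also have "\<dots> = (\<Prod>i=1..m. num_spanning G (V i))"
  proof (rule prod.cong)
    fix i assume i: "i \<in> {1..m}"
    then have "E \<inter> Pow (V i) = edges G \<inter> Pow (V i)" by (auto simp: E_def)
    then show "card (bases (E \<inter> Pow (V i))) = num_spanning G (V i)"
      using num_spanning_eq_card_bases[OF G VG(1)[OF i]] by simp
  qed simp
  finally have lower: "card (bases E) = (\<Prod>i=1..m. num_spanning G (V i))" .
  have "real (card (bases (E \<union> D))) \<le> real (card (bases E)) * exp (real b * (2 * ln (real n) + ln 2))"
  \<comment> \<open>With \<open>n = 0\<close> the bound \<open>2 * n ^ 2\<close> on
    \<open>1 + card (E \<union> D)\<close> breaks down. As each \<open>V i\<close> is nonempty,
    \<open>m = 0\<close> follows; there are no edges, \<open>b = 0\<close>, and the exponential is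
    1.\<close>
  proof (cases "n = 0")
    case True
    then have "W = {}" using n_eq finW by simp
    then have "m = 0" using VG(2)[of 1] by (cases m) (auto simp: W_def)
    moreover have "E \<union> D = {}" using edge \<open>W = {}\<close> by fastforce
    ultimately show ?thesis by (simp add: b_def total_edges_between_def)
  next
    case False
    \<comment> \<open>For \<open>n \<ge> 1\<close>, at most \<open>n ^ 2\<close> edges give
      \<open>1 + card (E \<union> D) \<le> 1 + n ^ 2 \<le> 2 * n ^ 2\<close>. The logarithm of this
      constant is the bracket \<open>2 * ln n + ln 2\<close> of the claim.\<close>
    define K where "K = 2 * n ^ 2"
    have K: "1 + card (E \<union> D) \<le> K"
      using card_edges_in_le[OF finW, of "E \<union> D"] edge False one_le_power[of n 2] unfolding K_def n_eq
      by fastforce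
    \<comment> \<open>Because \<open>K \<ge> 1\<close>, the exponent \<open>card D\<close> may be
      raised to \<open>b\<close>.\<close>
    have "card D \<le> b" using card_crossing_edges_le[OF G] by (simp add: D_def W_def b_def)
    then have "card (bases E) * K ^ card D \<le> card (bases E) * K ^ b"
      using K by (intro mult_left_mono power_increasing) auto
    with card_bases_Un_le[OF fin K] have "card (bases (E \<union> D)) \<le> card (bases E) * K ^ b"
      by (rule order_trans)
    then have "real (card (bases (E \<union> D))) \<le> real (card (bases E)) * real K ^ b"
      by (metis of_nat_le_iff of_nat_mult of_nat_power)
    also have "real K ^ b = exp (real b * (2 * ln (real n) + ln 2))"
    proof -
      have "ln (real K) = 2 * ln (real n) + ln 2"
        using False by (simp add: K_def ln_mult ln_realpow)
      moreover have "real K > 0" using False by (simp add: K_def)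
      ultimately show ?thesis by (metis exp_ln exp_of_nat_mult)
    qed
    finally show ?thesis .
  qed
  then show ?thesis
    using card_bases_mono_Un[OF fin] upper lower unfolding W_def b_def n_def by simp
qed

end
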